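(* Let $\{\Pi_m\}_{m\in\mathbb{N}}$ be a sequence of nonnegative discrete probability distributions converging weakly to a nonnegative distribution $\Pi$, and let $G_m\sim\mathrm{Erlang}(\xi(m),\xi(m))$, where $\xi(m)\in\mathbb{N}$ and $\xi(m)\to\infty$. Then $\Pi_m\star G_m\to\Pi$ weakly as $m\to\infty$.
   Context: $\mathrm{Erlang}(k,k)$ is the Gamma distribution with shape $k$ and rate $k$. For nonnegative distributions $\Pi$ and $G$, the Mellin--Stieltjes convolution $\Pi\star G$ is the distribution of the product of two independent random variables with distributions $\Pi$ and $G$; $\Pi\star G(u)=\int_0^\infty G(u/s)\,d\Pi(s)$. *)

theory Defs
  imports "HOL-Probability.Probability"
begin

definition nonneg_distribution :: "real measure \<Rightarrow> bool" where
  "nonneg_distribution M \<longleftrightarrow> real_distribution M \<and> (AE x in M. 0 \<le> x)"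

(* Countably many atoms; finite support is not required. *)
definition discrete_distribution :: "real measure \<Rightarrow> bool" where
  "discrete_distribution M \<longleftrightarrow> real_distribution M \<and> (\<exists>S. countable S \<and> (AE x in M. x \<in> S))"

(* Shape k \<ge> 1 and rate l > 0. The first argument of the library's erlang_density
   is the shape minus one. *)
definition erlang :: "nat \<Rightarrow> real \<Rightarrow> real measure" where
  "erlang k l = density lborel (\<lambda>x. ennreal (erlang_density (k - 1) l x))"

(* Not \<star>, which the library uses for additive convolution.
   The law of the product X * Y of independent X ~ P and Y ~ G. For P with an atom at 0
   the formula \<integral> G(u/s) dP(s) for its distribution function has to be read with
   G(u/0) = 1 for u \<ge> 0, which is not what division by zero in HOL gives. *)
definition mellin_stieltjes_conv :: "real measure \<Rightarrow> real measure \<Rightarrow> real measure"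
    (infixl "\<circledast>" 70) where
  "P \<circledast> G = distr (P \<Otimes>\<^sub>M G) borel (\<lambda>(x, y). x * y)"

end

(*
  Conditioning on the first factor, the characteristic function of P * G at t is the integral
  of char G (t x) over P. If G has mean 1 then char G (s) differs from exp(is) by at most
  |s| sd(G), which is |s| / sqrt k for Erlang(k, k). Realising the weakly convergent sequence
  as almost surely convergent random variables (Skorohod) and applying dominated convergence
  gives convergence of the characteristic functions, hence weak convergence by Levy.
*)
theory Submission
  imports Defs
begin

lemma norm_iexp_diff_le: "cmod (iexp a - iexp b) \<le> \<bar>a - b\<bar>"
proof -
  \<comment> \<open>The factor \<open>iexp b\<close> has modulus 1, so only the distance from
    \<open>iexp (a - b)\<close> to 1 remains, which the order-0 Taylor estimate bounds.\<close>
  have "iexp a - iexp b = iexp b * (iexp (a - b) - 1)"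
    by (simp add: algebra_simps flip: exp_add)
  then have "cmod (iexp a - iexp b) = cmod (iexp (a - b) - 1)"
    by (simp add: norm_mult)
  then show ?thesis
    using iexp_approx1[of "a - b" 0] by simp
qed

text \<open>The variance of \<open>\<bar>X\<bar>\<close> is nonnegative.\<close>

lemma (in prob_space) expectation_abs_le_sqrt:
  fixes X :: "'a \<Rightarrow> real"
  assumes "integrable M X" "integrable M (\<lambda>x. (X x)\<^sup>2)"
  shows "expectation (\<lambda>x. \<bar>X x\<bar>) \<le> sqrt (expectation (\<lambda>x. (X x)\<^sup>2))"
  using variance_eq[of "\<lambda>x. \<bar>X x\<bar>"] variance_positive[of "\<lambda>x. \<bar>X x\<bar>"] assms
  by (intro real_le_rsqrt) simp

text \<open>The Lipschitz bound on \<open>iexp\<close>, integrated, leaves the mean absolute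
  deviation from \<open>c\<close>, which the standard deviation dominates.\<close>

lemma (in real_distribution) norm_char_diff_iexp_le:
  assumes "integrable M (\<lambda>x. x)" "integrable M (\<lambda>x. x\<^sup>2)" and mean: "expectation (\<lambda>x. x) = c"
  shows "cmod (char M t - iexp (t * c)) \<le> \<bar>t\<bar> * sqrt (variance (\<lambda>x. x))"
proof -
  have int: "integrable M (\<lambda>x. iexp (t * x))"
    by (intro integrable_iexp) auto
  have "char M t - iexp (t * c) = (CLINT x|M. iexp (t * x) - iexp (t * c))"
    using int by (simp add: char_def prob_space del: space_eq_univ of_real_mult)
  also have "cmod \<dots> \<le> (LINT x|M. cmod (iexp (t * x) - iexp (t * c)))"
    by (rule integral_norm_bound)
  also have "\<dots> \<le> (LINT x|M. \<bar>t\<bar> * \<bar>x - c\<bar>)"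
  proof (rule integral_mono)
    show "integrable M (\<lambda>x. cmod (iexp (t * x) - iexp (t * c)))"
      using int by (intro integrable_norm Bochner_Integration.integrable_diff) auto
    show "cmod (iexp (t * x) - iexp (t * c)) \<le> \<bar>t\<bar> * \<bar>x - c\<bar>" for x
      using norm_iexp_diff_le[of "t * x" "t * c"] by (simp add: abs_mult flip: right_diff_distrib)
  qed (use assms in auto)
  also have "\<dots> = \<bar>t\<bar> * (LINT x|M. \<bar>x - c\<bar>)"
    by simp
  also have "\<dots> \<le> \<bar>t\<bar> * sqrt (LINT x|M. (x - c)\<^sup>2)"
    using assms by (intro mult_left_mono expectation_abs_le_sqrt) (auto simp: power2_diff)
  finally show ?thesis
    by (simp add: mean)
qed

lemma real_distribution_erlang:
  assumes "0 < l"
  shows "real_distribution (erlang k l)"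
  using prob_space_erlang_density[OF assms, of "k - 1"]
  by (simp add: erlang_def real_distribution_def real_distribution_axioms_def)

lemma
  assumes "0 < l" "1 \<le> k"
  shows integrable_erlang_moment: "integrable (erlang k l) (\<lambda>x. x ^ i)"
    and integral_erlang_id: "(LINT x|erlang k l. x) = k / l"
    and variance_erlang: "prob_space.variance (erlang k l) (\<lambda>x. x) = k / l\<^sup>2"
proof -
  interpret E: real_distribution "erlang k l"
    using assms(1) by (rule real_distribution_erlang)
  \<comment> \<open>Under \<open>erlang k l\<close> the identity is a random variable with Erlang
    density, so the known moment formulas apply to it.\<close>
  have D: "distributed (erlang k l) lborel (\<lambda>x. x) (erlang_density (k - 1) l)"
    using assms by (auto simp: distributed_def erlang_def distr_id2)
  show "integrable (erlang k l) (\<lambda>x. x ^ i)"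
    using E.erlang_ith_moment_integrable[OF \<open>0 < l\<close> D] .
  \<comment> \<open>With parameter \<open>k - 1\<close> the first moment is
    \<open>fact (k - 1 + 1) / (fact (k - 1) * l)\<close>; this cancels the factorials.\<close>
  have "fact k = (real k * fact (k - 1) :: real)"
    using assms by (simp add: fact_reduce)
  then show "(LINT x|erlang k l. x) = k / l"
    using E.erlang_ith_moment[OF \<open>0 < l\<close> D, of 1] assms by simp
  show "E.variance (\<lambda>x. x) = k / l\<^sup>2"
    using E.erlang_distributed_variance[OF \<open>0 < l\<close> D] assms by simp
qed

lemma norm_char_erlang_diff_iexp_le:
  assumes "1 \<le> k"
  shows "cmod (char (erlang k (real k)) s - iexp s) \<le> \<bar>s\<bar> / sqrt k"
proof -
  have k: "0 < real k"
    using assms by simp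
  interpret E: real_distribution "erlang k (real k)"
    using k by (rule real_distribution_erlang)
  have "integrable (erlang k (real k)) (\<lambda>x. x)" "integrable (erlang k (real k)) (\<lambda>x. x\<^sup>2)"
    using integrable_erlang_moment[OF k assms, of 1] integrable_erlang_moment[OF k assms, of 2]
    by simp_all
  \<comment> \<open>Equal shape and rate make the mean 1, written as a factor to match
    \<open>t * c\<close>.\<close>
  then have "cmod (char (erlang k (real k)) s - iexp (s * 1))
      \<le> \<bar>s\<bar> * sqrt (E.variance (\<lambda>x. x))"
    using integral_erlang_id[OF k assms] k by (intro E.norm_char_diff_iexp_le) simp_all
  also have "E.variance (\<lambda>x. x) = 1 / k"
    using variance_erlang[OF k assms] by (simp add: power2_eq_square)
  finally show ?thesis
    by (simp add: real_sqrt_divide)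
qed

lemma
  assumes "real_distribution P" "real_distribution G"
  shows real_distribution_mellin_stieltjes_conv: "real_distribution (P \<circledast> G)"
    and char_mellin_stieltjes_conv: "char (P \<circledast> G) t = (CLINT x|P. char G (t * x))"
proof -
  interpret P: real_distribution P by fact
  interpret G: real_distribution G by fact
  interpret PG: pair_prob_space P G ..
  have prod [measurable]: "(\<lambda>(x, y). x * y) \<in> borel_measurable (P \<Otimes>\<^sub>M G)"
    by measurable
  show "real_distribution (P \<circledast> G)"
    unfolding mellin_stieltjes_conv_def using prod by (rule PG.real_distribution_distr)
  \<comment> \<open>The integrand has modulus 1 on a probability space, which gives the joint
    integrability required by Fubini.\<close>
  have "integrable (P \<Otimes>\<^sub>M G) (\<lambda>z. iexp (t * (fst z * snd z)))"
    by (intro PG.integrable_iexp) auto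
  then have int: "integrable (P \<Otimes>\<^sub>M G) (\<lambda>(x, y). iexp (t * (x * y)))"
    by (simp add: case_prod_beta')
  have "char (P \<circledast> G) t = (CLINT z|P \<Otimes>\<^sub>M G. (case z of (x, y) \<Rightarrow> iexp (t * (x * y))))"
    by (simp add: char_def mellin_stieltjes_conv_def integral_distr case_prod_beta)
  also have "\<dots> = (CLINT x|P. CLINT y|G. iexp (t * (x * y)))"
    using PG.integral_fst'[OF int] by simp
  also have "\<dots> = (CLINT x|P. char G (t * x))"
    by (simp add: char_def mult.assoc)
  finally show "char (P \<circledast> G) t = (CLINT x|P. char G (t * x))" .
qed

text \<open>Since \<open>iexp\<close> is the characteristic function of the unit mass at 1,
  \<open>bound\<close> and \<open>e\<close> express quantitatively that \<open>G m\<close>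
  concentrates at 1.\<close>

lemma weak_conv_mellin_stieltjes_conv:
  assumes P: "\<And>m. real_distribution (P m)" and Q: "real_distribution Q"
    and G: "\<And>m. real_distribution (G m)" and conv: "weak_conv_m P Q"
    and bound: "\<And>m s. cmod (char (G m) s - iexp s) \<le> \<bar>s\<bar> * e m" and e: "e \<longlonglongrightarrow> 0"
  shows "weak_conv_m (\<lambda>m. P m \<circledast> G m) Q"
proof (rule levy_continuity)
  show "real_distribution (P m \<circledast> G m)" for m
    using P G by (rule real_distribution_mellin_stieltjes_conv)
  show "real_distribution Q"
    by fact
  fix t :: real
  \<comment> \<open>The integrand \<open>char (G n) (t * x)\<close> varies together with the measure
    \<open>P n\<close>; the coupling on \<open>\<Omega>\<close> leaves a single measure.\<close>
  obtain \<Omega> :: "real measure" and Y_seq :: "nat \<Rightarrow> real \<Rightarrow> real" and Y :: "real \<Rightarrow> real" where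
    \<Omega>: "prob_space \<Omega>" and
    Y_seq [measurable]: "\<And>n. Y_seq n \<in> borel_measurable \<Omega>" and
    distr_Y_seq: "\<And>n. distr \<Omega> borel (Y_seq n) = P n" and
    Y [measurable]: "Y \<in> borel_measurable \<Omega>" and
    distr_Y: "distr \<Omega> borel Y = Q" and
    lim: "\<And>x. x \<in> space \<Omega> \<Longrightarrow> (\<lambda>n. Y_seq n x) \<longlonglongrightarrow> Y x"
    using Skorohod[OF P Q conv] by force
  interpret prob_space \<Omega> by fact
  have [measurable]: "char (G n) \<in> borel_measurable borel" for n
    by (intro borel_measurable_continuous_onI continuous_at_imp_continuous_on ballI
        real_distribution.isCont_char G)
  have "(\<lambda>n. CLINT x|\<Omega>. char (G n) (t * Y_seq n x)) \<longlonglongrightarrow> (CLINT x|\<Omega>. iexp (t * Y x))"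
  \<comment> \<open>Characteristic functions are bounded by 1, which is integrable on a probability
    space.\<close>
  proof (rule integral_dominated_convergence[where w="\<lambda>_. 1"])
    show "AE x in \<Omega>. (\<lambda>n. char (G n) (t * Y_seq n x)) \<longlonglongrightarrow> iexp (t * Y x)"
    proof (rule AE_I2)
      fix x assume "x \<in> space \<Omega>"
      then have Yx: "(\<lambda>n. Y_seq n x) \<longlonglongrightarrow> Y x"
        by (rule lim)
      \<comment> \<open>Here \<open>bound\<close> is taken at the moving point
        \<open>t * Y_seq n x\<close>; its linear factor converges, so the product with
        \<open>e n\<close> still vanishes.\<close>
      have "(\<lambda>n. \<bar>t * Y_seq n x\<bar> * e n) \<longlonglongrightarrow> \<bar>t * Y x\<bar> * 0"
        by (intro tendsto_intros Yx e)
      then have "(\<lambda>n. char (G n) (t * Y_seq n x) - iexp (t * Y_seq n x)) \<longlonglongrightarrow> 0"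
        by (intro Lim_null_comparison[OF always_eventually[OF allI[OF bound]]]) simp
      moreover have "(\<lambda>n. iexp (t * Y_seq n x)) \<longlonglongrightarrow> iexp (t * Y x)"
        by (intro tendsto_intros Yx)
      ultimately show "(\<lambda>n. char (G n) (t * Y_seq n x)) \<longlonglongrightarrow> iexp (t * Y x)"
        by (rule Lim_transform[rotated])
    qed
    show "AE x in \<Omega>. cmod (char (G n) (t * Y_seq n x)) \<le> 1" for n
      by (intro AE_I2 real_distribution.cmod_char_le_1 G)
  qed auto
  moreover have "char (P n \<circledast> G n) t = (CLINT x|\<Omega>. char (G n) (t * Y_seq n x))" for n
    by (simp add: char_mellin_stieltjes_conv P G integral_distr flip: distr_Y_seq)
  moreover have "char Q t = (CLINT x|\<Omega>. iexp (t * Y x))"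
    unfolding char_def distr_Y[symmetric] by (simp add: integral_distr)
  ultimately show "(\<lambda>n. char (P n \<circledast> G n) t) \<longlonglongrightarrow> char Q t"
    by simp
qed

theorem proposition2p4:
  fixes P :: "nat \<Rightarrow> real measure" and Q :: "real measure"
    and G :: "nat \<Rightarrow> real measure" and \<xi> :: "nat \<Rightarrow> nat"
  assumes "\<And>m. nonneg_distribution (P m)"
    and "\<And>m. discrete_distribution (P m)"
    and "nonneg_distribution Q"
    and "weak_conv_m P Q"
    and "\<And>m. 1 \<le> \<xi> m"
    and "filterlim \<xi> at_top sequentially"
    and "\<And>m. G m = erlang (\<xi> m) (real (\<xi> m))"
  shows "weak_conv_m (\<lambda>m. P m \<circledast> G m) Q"
proof (rule weak_conv_mellin_stieltjes_conv)
  show "real_distribution (P m)" "real_distribution Q" for m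
    using assms(1,3) by (simp_all add: nonneg_distribution_def)
  have "0 < real (\<xi> m)" for m
    using assms(5)[of m] by simp
  then show "real_distribution (G m)" for m
    unfolding assms(7) by (rule real_distribution_erlang)
  \<comment> \<open>The error rate is the standard deviation of \<open>G m\<close>.\<close>
  show "cmod (char (G m) s - iexp s) \<le> \<bar>s\<bar> * (1 / sqrt (\<xi> m))" for m s
    using norm_char_erlang_diff_iexp_le[OF assms(5)] by (simp add: assms(7))
  show "(\<lambda>m. 1 / sqrt (\<xi> m)) \<longlonglongrightarrow> 0"
    by (intro tendsto_divide_0[OF tendsto_const] filterlim_at_top_imp_at_infinity
        filterlim_compose[OF sqrt_at_top] filterlim_compose[OF filterlim_real_sequentially] assms(6))
qed (fact assms(4))

end
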